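(* Let $k,m\in\mathbb{N}$ and let $H_1,\ldots,H_m$ be pairwise non-isomorphic $k$-vertex graphs such that $H_i\not\cong\overline{H_j}$ for all distinct $i,j\in\{1,\ldots,m\}$. Let $\mathcal{B}:=\bigcup_{i=1}^m\widetilde{H_i}(G)$. Then $(V,\mathcal{B})$ forms a $2$-$(q,k,\lambda)$-design, where $$\lambda=\binom{k}{2}\binom{q}{2}^{-1}\sum_{i=1}^m|\widetilde{H_i}(G)|.$$
   Context: Let $\mathbb{N}$ be the set of positive integers, and let $p,q,r\in\mathbb{N}$ with $p$ prime, $q=p^r$ and $q\equiv 1 \pmod 4$. The graph $G$ is fixed as follows. If $r$ is odd or $p\not\equiv 3\pmod 4$, $G$ is the $q$-vertex Paley graph. If $r$ is even and $p\equiv 3\pmod 4$, $G$ is either the $q$-vertex Paley graph or the $q$-vertex Peisert graph (the result holds for either choice). The $q$-vertex Paley graph has vertex set $\mathrm{GF}(q)$ and edges all $\{x,y\}$ with $x\ne y$ and $x-y$ a quadratic residue (nonzero square) in $\mathrm{GF}(q)$. The $q$-vertex Peisert graph (for $p\equiv 3\pmod 4$, $r$ even) has vertex set $\mathrm{GF}(q)$ and edges all $\{x,y\}$ such that $x-y=\omega^j$ for some $j$ with $j\equiv 0$ or $1\pmod 4$, where $\omega$ is a fixed primitive root (generator of the multiplicative group) of $\mathrm{GF}(q)$. $V$ denotes the vertex set of $G$. All graphs are finite and simple. $G[X]$ is the subgraph of $G$ induced by $X\subseteq V$. For a graph $H$, $\overline{H}$ is its complement, $H(G):=\{X\subseteq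 V: G[X]\cong H\}$, and $\widetilde{H}(G):=H(G)\cup\overline{H}(G)$. A pair $(V,\mathcal{B})$ with $|V|=q$ and $\mathcal{B}$ a set of subsets of $V$ (blocks, none repeated) is a $2$-$(q,k,\lambda)$-design if every block has exactly $k$ elements and every pair of distinct elements of $V$ is contained in exactly $\lambda$ blocks; degenerate cases such as $\lambda=0$ are allowed. *)

theory Defs
  imports Complex_Main "HOL-Library.Cardinality" "HOL-Computational_Algebra.Primes" "Graph_Theory.Graph_Theory"
begin

text \<open>
  Finite simple graphs are the \<^locale>\<open>pair_graph\<close>s of the AFP: finite, loop-free and with a
  symmetric arc relation, so that an edge \<open>{x, y}\<close> is represented by the two arcs
  \<open>(x, y)\<close> and \<open>(y, x)\<close>.
\<close>

definition graph_of_edges :: "'a set \<Rightarrow> 'a set set \<Rightarrow> 'a pair_pre_digraph" where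
  "graph_of_edges V E = \<lparr>pverts = V, parcs = {(x, y). {x, y} \<in> E}\<rparr>"

lemma pair_graph_graph_of_edges:
  assumes "finite V" and "\<And>e. e \<in> E \<Longrightarrow> e \<subseteq> V \<and> card e = 2"
  shows "pair_graph (graph_of_edges V E)"
proof -
  have sub: "x \<in> V \<and> y \<in> V \<and> x \<noteq> y" if "{x, y} \<in> E" for x y
    using assms(2)[OF that] by (auto simp: card_insert_if split: if_splits)
  have "{(x, y). {x, y} \<in> E} \<subseteq> V \<times> V"
    using sub by auto
  then have "finite {(x, y). {x, y} \<in> E}"
    using assms(1) by (meson finite_SigmaI finite_subset)
  then show ?thesis
    using assms(1)
    by unfold_locales
      (auto simp: graph_of_edges_def symmetric_def sym_def insert_commute dest: sub)
qed

definition graph_complement :: "'a pair_pre_digraph \<Rightarrow> 'a pair_pre_digraph" where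
  "graph_complement H =
     \<lparr>pverts = pverts H,
      parcs = {(x, y). x \<in> pverts H \<and> y \<in> pverts H \<and> x \<noteq> y \<and> (x, y) \<notin> parcs H}\<rparr>"

lemma pair_graph_graph_complement:
  assumes "pair_graph H"
  shows "pair_graph (graph_complement H)"
proof -
  interpret pair_graph H by (rule assms)
  let ?A = "{(x, y). x \<in> pverts H \<and> y \<in> pverts H \<and> x \<noteq> y \<and> (x, y) \<notin> parcs H}"
  have "?A \<subseteq> pverts H \<times> pverts H"
    by auto
  then have "finite ?A"
    using pair_finite_verts by (meson finite_SigmaI finite_subset)
  moreover have "sym (parcs H)"
    using pair_sym_arcs by (simp add: symmetric_def)
  ultimately show ?thesis
    using pair_finite_verts
    by unfold_locales (auto simp: graph_complement_def symmetric_def sym_def)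
qed

text \<open>
  On simple graphs, isomorphism of the underlying digraphs is the usual graph isomorphism.
\<close>

lemma digraph_iso_with_proj_iff:
  assumes "pair_wf_digraph G" and "pair_wf_digraph H"
  shows "digraph_iso (with_proj G) (with_proj H) \<longleftrightarrow>
    (\<exists>f. bij_betw f (pverts G) (pverts H) \<and>
       (\<forall>x\<in>pverts G. \<forall>y\<in>pverts G. (x, y) \<in> parcs G \<longleftrightarrow> (f x, f y) \<in> parcs H))"
    (is "_ \<longleftrightarrow> ?R")
proof
  interpret G: pair_wf_digraph G by (rule assms(1))
  interpret H: pair_wf_digraph H by (rule assms(2))
  {
    assume "digraph_iso (with_proj G) (with_proj H)"
    then obtain h where h: "pre_digraph.digraph_isomorphism (with_proj G) h"
      and eq: "with_proj H = app_iso h (with_proj G)"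
      unfolding digraph_iso_def by blast
    let ?f = "iso_verts h"
    have inj: "inj_on ?f (pverts G)"
      using h by (auto simp: pre_digraph.digraph_isomorphism_def)
    have hd: "iso_head h = snd" "iso_tail h = fst"
      and img: "?f ` pverts G = pverts H" "iso_arcs h ` parcs G = parcs H"
      using eq by (auto simp: with_proj_def app_iso_def)
    have arc: "iso_arcs h (x, y) = (?f x, ?f y)" if "(x, y) \<in> parcs G" for x y
      using h that hd by (auto simp: pre_digraph.digraph_isomorphism_def prod_eq_iff)
    have "(x, y) \<in> parcs G \<longleftrightarrow> (?f x, ?f y) \<in> parcs H"
      if "x \<in> pverts G" "y \<in> pverts G" for x y
    proof
      assume "(x, y) \<in> parcs G"
      then show "(?f x, ?f y) \<in> parcs H"
        using arc img by (metis imageI)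
    next
      assume "(?f x, ?f y) \<in> parcs H"
      then obtain u v where uv: "(u, v) \<in> parcs G" "iso_arcs h (u, v) = (?f x, ?f y)"
        using img by (metis (no_types, opaque_lifting) imageE surj_pair)
      then have "?f u = ?f x" "?f v = ?f y" "u \<in> pverts G" "v \<in> pverts G"
        using arc[OF uv(1)] G.in_arcsD1[OF uv(1)] G.in_arcsD2[OF uv(1)] by simp_all
      then show "(x, y) \<in> parcs G"
        using inj that uv(1) by (metis inj_onD)
    qed
    then show ?R
      using inj img(1) by (auto simp: bij_betw_def intro!: exI[of _ ?f])
  }
  {
    assume ?R
    then obtain f where f: "bij_betw f (pverts G) (pverts H)"
      and arc: "\<And>x y. x \<in> pverts G \<Longrightarrow> y \<in> pverts G \<Longrightarrow>
        (x, y) \<in> parcs G \<longleftrightarrow> (f x, f y) \<in> parcs H"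
      by blast
    have inj: "inj_on f (pverts G)" and img: "f ` pverts G = pverts H"
      using f by (auto simp: bij_betw_def)
    define h where
      "h = \<lparr>iso_verts = f, iso_arcs = map_prod f f, iso_head = snd, iso_tail = fst\<rparr>"
    have "inj_on (map_prod f f) (parcs G)"
      by (rule inj_on_subset[OF map_prod_inj_on[OF inj inj]])
        (auto dest: G.in_arcsD1 G.in_arcsD2)
    then have "pre_digraph.digraph_isomorphism (with_proj G) h"
      using inj G.wf_digraph by (simp add: pre_digraph.digraph_isomorphism_def h_def)
    moreover have "map_prod f f ` parcs G = parcs H"
    proof (intro set_eqI iffI)
      fix e assume "e \<in> map_prod f f ` parcs G"
      then show "e \<in> parcs H"
        using arc by (auto dest: G.in_arcsD1 G.in_arcsD2)
    next
      fix e assume "e \<in> parcs H"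
      moreover obtain a b where "e = (a, b)"
        by (cases e)
      ultimately have "a \<in> f ` pverts G" "b \<in> f ` pverts G"
        using H.in_arcsD1 H.in_arcsD2 img by blast+
      then obtain x y where "e = (f x, f y)" "x \<in> pverts G" "y \<in> pverts G"
        using \<open>e = (a, b)\<close> by blast
      with \<open>e \<in> parcs H\<close> show "e \<in> map_prod f f ` parcs G"
        using arc by (auto intro!: image_eqI[of _ _ "(x, y)"])
    qed
    then have "with_proj H = app_iso h (with_proj G)"
      using img by (simp add: with_proj_def app_iso_def h_def)
    ultimately show "digraph_iso (with_proj G) (with_proj H)"
      unfolding digraph_iso_def by blast
  }
qed

definition induced_copies :: "'b pair_pre_digraph \<Rightarrow> 'a pair_pre_digraph \<Rightarrow> 'a set set" where
  "induced_copies H G = {X. X \<subseteq> pverts G \<and> digraph_iso (with_proj G \<restriction> X) (with_proj H)}"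

text \<open>\<open>induced_copies H G\<close> is $H(G)$, and the following is $\widetilde{H}(G)$.\<close>

definition induced_copies_tilde :: "'b pair_pre_digraph \<Rightarrow> 'a pair_pre_digraph \<Rightarrow> 'a set set" where
  "induced_copies_tilde H G = induced_copies H G \<union> induced_copies (graph_complement H) G"

text \<open>\<open>GF(q)\<close> is a type \<open>'a\<close> of class field and finite with \<open>CARD('a) = q\<close>.\<close>

definition quadratic_residue :: "'a::field \<Rightarrow> bool" where
  "quadratic_residue a \<longleftrightarrow> a \<noteq> 0 \<and> (\<exists>z. a = z ^ 2)"

definition primitive_root :: "'a::field \<Rightarrow> bool" where
  "primitive_root w \<longleftrightarrow> w \<noteq> 0 \<and> (\<forall>x. x \<noteq> 0 \<longrightarrow> (\<exists>j::nat. x = w ^ j))"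

definition paley_graph :: "'a::{field,finite} pair_pre_digraph" where
  "paley_graph = graph_of_edges UNIV {{x, y} | x y. x \<noteq> y \<and> quadratic_residue (x - y)}"

definition peisert_graph :: "'a::{field,finite} \<Rightarrow> 'a pair_pre_digraph" where
  "peisert_graph w = graph_of_edges UNIV
     {{x, y} | x y. \<exists>j::nat. (j mod 4 = 0 \<or> j mod 4 = 1) \<and> x - y = w ^ j}"

lemma pair_graph_paley_graph: "pair_graph paley_graph"
  unfolding paley_graph_def by (rule pair_graph_graph_of_edges) auto

lemma pair_graph_peisert_graph:
  assumes "primitive_root w"
  shows "pair_graph (peisert_graph w)"
proof -
  have "x \<noteq> y" if "x - y = w ^ j" for x y and j :: nat
    using assms that by (auto simp: primitive_root_def)
  then show ?thesis
    unfolding peisert_graph_def by (intro pair_graph_graph_of_edges) auto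
qed

text \<open>The blocks form a set, so no block is repeated; \<open>l = 0\<close> and \<open>B = {}\<close> are allowed.\<close>

definition two_design :: "'a set \<Rightarrow> 'a set set \<Rightarrow> nat \<Rightarrow> nat \<Rightarrow> nat \<Rightarrow> bool" where
  "two_design V B q k l \<longleftrightarrow>
     finite V \<and> card V = q \<and>
     (\<forall>b\<in>B. b \<subseteq> V \<and> card b = k) \<and>
     (\<forall>x\<in>V. \<forall>y\<in>V. x \<noteq> y \<longrightarrow> card {b \<in> B. x \<in> b \<and> y \<in> b} = l)"

end

theory Submission
  imports Defs "HOL-Number_Theory.Residues"
begin

text \<open>
  Write \<open>\<Phi>\<close> for the set of permutations of \<open>V\<close> that preserve adjacency in \<open>G\<close> or exchange
  adjacent and non-adjacent pairs. Isomorphism up to complementation is an equivalence relation,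
  its classes in the subsets of \<open>V\<close> are invariant under \<open>\<Phi>\<close>, and the set of \<open>X\<close> that are related
  to \<open>H\<close> is \<open>induced_copies_tilde H G\<close>. So every union \<open>\<B>\<close> of such sets is invariant under \<open>\<Phi>\<close>.

  The point is that \<open>\<Phi>\<close> acts doubly transitively on \<open>V\<close>. Fix a primitive root \<open>w\<close> and let the class
  of \<open>w ^ j\<close> be \<open>j mod 4\<close>. In the Paley graph the differences of adjacent vertices are the elements
  of class 0 or 2, in the Peisert graph those of class 0 or 1 (in both cases this uses the class
  of \<open>- 1\<close>, since adjacency has to be symmetric). Multiplication by \<open>w ^ e\<close> adds \<open>e\<close> to all
  classes. For the Paley graph this respects the partition into even and odd classes whatever \<open>e\<close>
  is, so all affine maps lie in \<open>\<Phi>\<close>. For the Peisert graph only even \<open>e\<close> respect the partition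
  into the classes \<open>{0, 1}\<close> and \<open>{2, 3}\<close>; but there the map \<open>z \<mapsto> z ^ p\<close> is additive and, as
  \<open>p \<equiv> 3 (mod 4)\<close>, changes the sign of every class, so that \<open>z \<mapsto> w ^ e * z ^ p\<close> is in \<open>\<Phi>\<close> for
  odd \<open>e\<close>. Together with the translations these maps take any ordered pair of distinct
  vertices to any other.

  By double transitivity the number \<open>\<lambda>\<close> of blocks on a pair is constant. Counting the
  incidences between pairs and blocks in two ways gives
  \<open>\<lambda> * (q choose 2) = card \<B> * (k choose 2)\<close>, and \<open>card \<B>\<close> is the sum in the theorem because
  distinct \<open>H i\<close> are inequivalent, which makes the sets in the union disjoint.
\<close>

section \<open>Isomorphism up to complementation\<close>

text \<open>
  The truth value \<open>s\<close> says whether \<open>f\<close> preserves or reverses the relation. Keeping both cases under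
  one quantifier makes the relation an equivalence with short proofs. Diagonal pairs are
  left out because complementation of a simple graph does not create loops.
\<close>

definition iso_or_anti :: "'a rel \<Rightarrow> 'a set \<Rightarrow> 'b rel \<Rightarrow> 'b set \<Rightarrow> bool" where
  "iso_or_anti R A S B \<longleftrightarrow> (\<exists>f s. bij_betw f A B \<and>
     (\<forall>x\<in>A. \<forall>y\<in>A. x \<noteq> y \<longrightarrow> (((x, y) \<in> R \<longleftrightarrow> (f x, f y) \<in> S) \<longleftrightarrow> s)))"

lemma iso_or_anti_sym:
  assumes "iso_or_anti R A S B"
  shows "iso_or_anti S B R A"
proof -
  obtain f s where f: "bij_betw f A B"
    and s: "\<forall>x\<in>A. \<forall>y\<in>A. x \<noteq> y \<longrightarrow> (((x, y) \<in> R \<longleftrightarrow> (f x, f y) \<in> S) \<longleftrightarrow> s)"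
    using assms unfolding iso_or_anti_def by (elim exE conjE)
  let ?g = "inv_into A f"
  have g: "bij_betw ?g B A"
    by (rule bij_betw_inv_into[OF f])
  have fg: "f (?g u) = u" "?g u \<in> A" if "u \<in> B" for u
    using that f g by (auto simp: bij_betw_inv_into_right bij_betwE)
  have "((u, v) \<in> S \<longleftrightarrow> (?g u, ?g v) \<in> R) \<longleftrightarrow> s" if "u \<in> B" "v \<in> B" "u \<noteq> v" for u v
  proof -
    have "?g u \<noteq> ?g v"
      using fg that by metis
    then show ?thesis
      using s[rule_format, of "?g u" "?g v"] fg that by simp blast
  qed
  then show ?thesis
    unfolding iso_or_anti_def by (intro exI[of _ ?g] exI[of _ s] conjI g) auto
qed

lemma iso_or_anti_trans:
  assumes "iso_or_anti R A S B" and "iso_or_anti S B T C"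
  shows "iso_or_anti R A T C"
proof -
  obtain f s where f: "bij_betw f A B"
    and s: "\<forall>x\<in>A. \<forall>y\<in>A. x \<noteq> y \<longrightarrow> (((x, y) \<in> R \<longleftrightarrow> (f x, f y) \<in> S) \<longleftrightarrow> s)"
    using assms(1) unfolding iso_or_anti_def by (elim exE conjE)
  obtain g t where g: "bij_betw g B C"
    and t: "\<forall>x\<in>B. \<forall>y\<in>B. x \<noteq> y \<longrightarrow> (((x, y) \<in> S \<longleftrightarrow> (g x, g y) \<in> T) \<longleftrightarrow> t)"
    using assms(2) unfolding iso_or_anti_def by (elim exE conjE)
  have "((x, y) \<in> R \<longleftrightarrow> ((g \<circ> f) x, (g \<circ> f) y) \<in> T) \<longleftrightarrow> (s \<longleftrightarrow> t)"
    if "x \<in> A" "y \<in> A" "x \<noteq> y" for x y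
  proof -
    have "f x \<in> B" "f y \<in> B" "f x \<noteq> f y"
      using that f by (auto simp: bij_betw_def inj_on_def)
    then show ?thesis
      using s[rule_format, OF that] t[rule_format, of "f x" "f y"] by auto
  qed
  then show ?thesis
    unfolding iso_or_anti_def
    by (intro exI[of _ "g \<circ> f"] exI[of _ "s \<longleftrightarrow> t"] conjI bij_betw_trans[OF f g]) auto
qed

lemma iso_or_anti_imp_card_eq: "iso_or_anti R A S B \<Longrightarrow> card A = card B"
  unfolding iso_or_anti_def by (auto dest: bij_betw_same_card)

lemma digraph_iso_or_complement_iff:
  assumes "pair_graph G" and "pair_graph H"
  shows "digraph_iso (with_proj G) (with_proj H) \<or>
      digraph_iso (with_proj G) (with_proj (graph_complement H)) \<longleftrightarrow>
    iso_or_anti (parcs G) (pverts G) (parcs H) (pverts H)"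
proof -
  interpret G: pair_graph G by fact
  interpret H: pair_graph H by fact
  interpret C: pair_graph "graph_complement H"
    by (rule pair_graph_graph_complement) fact
  have loops: "(x, x) \<notin> parcs G" "(u, u) \<notin> parcs H" for x u
    using G.no_loops H.no_loops by fastforce+
  have iso: "digraph_iso (with_proj G) (with_proj H) \<longleftrightarrow>
    (\<exists>f. bij_betw f (pverts G) (pverts H) \<and> (\<forall>x\<in>pverts G. \<forall>y\<in>pverts G.
       x \<noteq> y \<longrightarrow> ((x, y) \<in> parcs G \<longleftrightarrow> (f x, f y) \<in> parcs H)))"
    unfolding digraph_iso_with_proj_iff[OF G.pair_wf_digraph_axioms H.pair_wf_digraph_axioms]
    by (intro ex_cong1 conj_cong ball_cong) (auto simp: loops)
  have co: "digraph_iso (with_proj G) (with_proj (graph_complement H)) \<longleftrightarrow>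
    (\<exists>f. bij_betw f (pverts G) (pverts H) \<and> (\<forall>x\<in>pverts G. \<forall>y\<in>pverts G.
       x \<noteq> y \<longrightarrow> ((x, y) \<in> parcs G \<longleftrightarrow> (f x, f y) \<notin> parcs H)))"
    unfolding digraph_iso_with_proj_iff[OF G.pair_wf_digraph_axioms C.pair_wf_digraph_axioms]
    unfolding graph_complement_def
    by (intro ex_cong1 conj_cong ball_cong) (auto simp: loops bij_betw_def inj_on_eq_iff)
  show ?thesis
    unfolding iso co iso_or_anti_def ex_bool_eq by (simp add: ex_disj_distrib conj_disj_distribL)
qed

text \<open>
  Membership in \<open>induced_copies_tilde H G\<close> thus depends on a vertex set only up to
  \<^const>\<open>iso_or_anti\<close>. The invariance of the blocks and the disjointness of the sets of copies
  both follow from this by symmetry and transitivity.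
\<close>

lemma induced_copies_tilde_eq:
  assumes "pair_graph G" and "pair_graph H"
  shows "induced_copies_tilde H G =
    {X. X \<subseteq> pverts G \<and> iso_or_anti (parcs G) X (parcs H) (pverts H)}"
proof -
  interpret G: pair_graph G by fact
  have "X \<in> induced_copies_tilde H G \<longleftrightarrow> iso_or_anti (parcs G) X (parcs H) (pverts H)"
    if X: "X \<subseteq> pverts G" for X
  proof -
    let ?S = "\<lparr>pverts = X, parcs = {e \<in> parcs G. fst e \<in> X \<and> snd e \<in> X}\<rparr>"
    have S: "with_proj G \<restriction> X = with_proj ?S"
      by (simp add: induce_subgraph_def with_proj_def)
    have "finite X"
      using X G.pair_finite_verts finite_subset by blast
    then have "pair_graph ?S"
      using G.pair_sym_arcs G.no_loops G.pair_finite_arcs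
      by unfold_locales (auto simp: symmetric_def sym_def)
    then have "X \<in> induced_copies_tilde H G \<longleftrightarrow>
        iso_or_anti (parcs ?S) (pverts ?S) (parcs H) (pverts H)"
      using digraph_iso_or_complement_iff[OF _ assms(2), of ?S] X
      by (simp add: induced_copies_tilde_def induced_copies_def S)
    then show ?thesis
      by (simp add: iso_or_anti_def)
  qed
  then show ?thesis
    by (auto simp: induced_copies_tilde_def induced_copies_def)
qed

section \<open>Designs from doubly transitive actions\<close>

text \<open>
  Blocks through \<open>x\<close> and \<open>y\<close> are mapped injectively to blocks through the images. As the pairs can
  be exchanged, this inequality alone makes the pair degrees equal, and the maps need not be
  collected into a group.
\<close>

lemma two_design_if_doubly_transitive:
  assumes fin: "finite V" and two: "card V \<ge> 2"
    and blocks: "\<And>b. b \<in> B \<Longrightarrow> b \<subseteq> V \<and> card b = k"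
    and trans: "\<And>x y x' y'. \<lbrakk>x \<in> V; y \<in> V; x \<noteq> y; x' \<in> V; y' \<in> V; x' \<noteq> y'\<rbrakk> \<Longrightarrow>
      \<exists>\<phi>. inj_on \<phi> V \<and> \<phi> x = x' \<and> \<phi> y = y' \<and> (\<forall>b\<in>B. \<phi> ` b \<in> B)"
  shows "\<exists>l. two_design V B (card V) k l \<and> l * (card V choose 2) = card B * (k choose 2)"
proof -
  define deg where "deg x y = card {b \<in> B. x \<in> b \<and> y \<in> b}" for x y
  have finB: "finite B"
    using blocks fin by (meson PowI finite_Pow_iff finite_subset subsetI)
  have le: "deg x y \<le> deg x' y'"
    if "x \<in> V" "y \<in> V" "x \<noteq> y" "x' \<in> V" "y' \<in> V" "x' \<noteq> y'" for x y x' y'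
  proof -
    obtain \<phi> where \<phi>: "inj_on \<phi> V" "\<phi> x = x'" "\<phi> y = y'" "\<forall>b\<in>B. \<phi> ` b \<in> B"
      using trans[OF \<open>x \<in> V\<close> \<open>y \<in> V\<close> \<open>x \<noteq> y\<close> \<open>x' \<in> V\<close> \<open>y' \<in> V\<close> \<open>x' \<noteq> y'\<close>] by blast
    have "inj_on ((`) \<phi>) {b \<in> B. x \<in> b \<and> y \<in> b}"
      by (rule inj_on_subset[OF inj_on_image_Pow[OF \<phi>(1)]]) (use blocks in auto)
    moreover have "(`) \<phi> ` {b \<in> B. x \<in> b \<and> y \<in> b} \<subseteq> {b \<in> B. x' \<in> b \<and> y' \<in> b}"
      using \<phi> by auto
    ultimately show ?thesis
      unfolding deg_def using finB by (intro card_inj_on_le) auto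
  qed
  obtain x0 y0 where xy0: "x0 \<in> V" "y0 \<in> V" "x0 \<noteq> y0"
    using two by (metis card_le_Suc0_iff_eq[OF fin] not_less_eq_eq numeral_2_eq_2)
  define l where "l = deg x0 y0"
  have l: "deg x y = l" if "x \<in> V" "y \<in> V" "x \<noteq> y" for x y
    unfolding l_def using le xy0 that by (meson le_antisym)
  let ?P = "{e. e \<subseteq> V \<and> card e = 2}"
  have "card {b \<in> B. e \<subseteq> b} = l" if e: "e \<in> ?P" for e
  proof -
    obtain x y where "e = {x, y}" "x \<noteq> y"
      using e by (auto simp: card_2_iff)
    then show ?thesis
      using l[of x y] e by (simp add: deg_def)
  qed
  then have "(\<Sum>b\<in>B. card {e \<in> ?P. e \<subseteq> b}) = l * card ?P"
    using finB fin by (intro sum_multicount) auto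
  moreover have "card {e \<in> ?P. e \<subseteq> b} = k choose 2" if "b \<in> B" for b
  proof -
    have "{e \<in> ?P. e \<subseteq> b} = {e. e \<subseteq> b \<and> card e = 2}"
      using blocks[OF that] by auto
    then show ?thesis
      using n_subsets[of b 2] blocks[OF that] fin finite_subset by metis
  qed
  ultimately have "l * (card V choose 2) = card B * (k choose 2)"
    using n_subsets[OF fin, of 2] by simp
  moreover have "two_design V B (card V) k l"
    using fin blocks l by (simp add: two_design_def deg_def)
  ultimately show ?thesis
    by blast
qed

section \<open>Discrete logarithms modulo 4 in a finite field\<close>

text \<open>
  The multiplicative group of a finite field is cyclic. This fact is about rings with explicit
  carriers, so the field operations of the type are packed into such a ring.
\<close>

lemma ex_primitive_root: "\<exists>w::'a::{field,finite}. primitive_root w"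
proof -
  define R where
    "R = \<lparr>carrier = (UNIV :: 'a set), mult = (*), one = 1 :: 'a,
       zero = 0 :: 'a, add = (+)\<rparr>"
  have "Group.comm_monoid R"
    by (rule comm_monoidI) (auto simp: R_def mult_ac)
  moreover have "abelian_group R"
  proof (rule abelian_groupI)
    fix x assume "x \<in> carrier R"
    show "\<exists>y\<in>carrier R. y \<oplus>\<^bsub>R\<^esub> x = \<zero>\<^bsub>R\<^esub>"
      by (rule bexI[of _ "- x"]) (auto simp: R_def)
  qed (auto simp: R_def add_ac)
  ultimately have "cring R"
    by (intro cringI) (auto simp: R_def distrib_right)
  then interpret R: field R
  proof (rule cring.cring_fieldI2)
    fix a assume "a \<in> carrier R" "a \<noteq> \<zero>\<^bsub>R\<^esub>"
    then show "\<exists>b\<in>carrier R. a \<otimes>\<^bsub>R\<^esub> b = \<one>\<^bsub>R\<^esub>"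
      by (intro bexI[of _ "inverse a"]) (auto simp: R_def)
  qed (simp add: R_def)
  have pow: "x [^]\<^bsub>R\<^esub> i = x ^ i" for x and i :: nat
    by (induction i) (auto simp: R_def mult_ac)
  have carrier: "carrier (mult_of R) = UNIV - {0}"
    by (simp add: R_def)
  have "finite (carrier R)"
    by (simp add: R_def)
  then have "\<exists>a\<in>carrier (mult_of R).
      carrier (mult_of R) = {a [^]\<^bsub>R\<^esub> i | i::nat. i \<in> UNIV}"
    by (rule R.finite_field_mult_group_has_gen)
  then obtain a where a: "a \<in> carrier (mult_of R)"
    and gen: "carrier (mult_of R) = {a [^]\<^bsub>R\<^esub> i | i::nat. i \<in> UNIV}"
    by (elim bexE)
  have "a \<noteq> 0"
    using a unfolding carrier by simp
  moreover have "\<exists>j. x = a ^ j" if "x \<noteq> 0" for x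
  proof -
    have "x \<in> carrier (mult_of R)"
      using that unfolding carrier by simp
    then show ?thesis
      unfolding gen mem_Collect_eq pow by blast
  qed
  ultimately have "primitive_root a"
    by (simp add: primitive_root_def)
  then show ?thesis ..
qed

text \<open>
  If \<open>w ^ e = 1\<close>, then the powers of \<open>w\<close> take at most \<open>e\<close> values, but they cover all non-zero
  elements. So the order of \<open>w\<close> is at least \<open>CARD('a) - 1\<close>, and by the pigeonhole principle not
  larger.
\<close>

lemma primitive_root_power_eq_1_dvd:
  fixes w :: "'a::{field,finite}"
  assumes w: "primitive_root w" and "w ^ d = 1"
  shows "CARD('a) - 1 dvd d"
proof -
  let ?n = "CARD('a) - 1"
  have w0: "w \<noteq> 0"
    using w by (simp add: primitive_root_def)
  have card: "card (UNIV - {0 :: 'a}) = ?n"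
    by simp
  have n: "?n > 0"
    using card by (metis DiffI UNIV_I card_gt_0_iff empty_iff finite insertE zero_neq_one)
  have reduce: "w ^ j = w ^ (j mod e)" if "w ^ e = 1" for j e
  proof -
    have "w ^ j = w ^ (e * (j div e) + j mod e)"
      by simp
    also have "\<dots> = w ^ (j mod e)"
      by (simp only: power_add power_mult that power_one mult_1)
    finally show ?thesis .
  qed
  have ge: "?n \<le> e" if "e > 0" "w ^ e = 1" for e
  proof -
    have "UNIV - {0} \<subseteq> (\<lambda>j. w ^ j) ` {..<e}"
    proof
      fix x assume "x \<in> UNIV - {0 :: 'a}"
      then obtain j where "x = w ^ j"
        using w by (auto simp: primitive_root_def)
      then show "x \<in> (\<lambda>j. w ^ j) ` {..<e}"
        using reduce[OF \<open>w ^ e = 1\<close>, of j] \<open>e > 0\<close> by (auto intro!: image_eqI[of _ _ "j mod e"])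
    qed
    then have "?n \<le> card ((\<lambda>j. w ^ j) ` {..<e})"
      unfolding card[symmetric] by (intro card_mono) auto
    also have "\<dots> \<le> e"
      using card_image_le[of "{..<e}" "\<lambda>j. w ^ j"] by simp
    finally show ?thesis .
  qed
  \<comment> \<open>The \<open>?n + 1\<close> powers up to \<open>?n\<close> lie among the \<open>?n\<close> non-zero elements, so two of them agree.\<close>
  have "\<not> inj_on (\<lambda>j. w ^ j) {..?n}"
  proof
    assume "inj_on (\<lambda>j. w ^ j) {..?n}"
    then have "card {..?n} \<le> card (UNIV - {0 :: 'a})"
      using w0 by (intro card_inj_on_le) auto
    then show False
      using n by simp
  qed
  then obtain i j where ij: "i < j" "j \<le> ?n" "w ^ i = w ^ j"
    by (auto simp: inj_on_def) (metis linorder_neqE_nat)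
  then have "w ^ i * w ^ (j - i) = w ^ i * 1"
    by (metis le_add_diff_inverse less_imp_le mult_1_right power_add)
  then have "w ^ (j - i) = 1"
    using w0 by simp
  moreover from this have "j - i = ?n"
    using ge[of "j - i"] ij by linarith
  ultimately have "w ^ ?n = 1"
    by simp
  then have "w ^ (d mod ?n) = 1"
    using reduce[of ?n d] assms(2) by simp
  then have "d mod ?n = 0"
    using ge[of "d mod ?n"] n by (metis mod_less_divisor not_gr_zero not_less)
  then show ?thesis
    by auto
qed

definition dlog4 :: "'a::field \<Rightarrow> 'a \<Rightarrow> nat" where
  "dlog4 w x = (SOME j. x = w ^ j) mod 4"

locale field_1_mod_4 =
  fixes w :: "'a::{field,finite}"
  assumes primitive_root: "primitive_root w"
    and CARD_mod_4: "CARD('a) mod 4 = 1"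
begin

lemma w_nonzero: "w \<noteq> 0"
  using primitive_root by (simp add: primitive_root_def)

lemma ex_power: "x \<noteq> 0 \<Longrightarrow> \<exists>j. x = w ^ j"
  using primitive_root by (simp add: primitive_root_def)

lemma four_dvd: "4 dvd CARD('a) - 1"
  using CARD_mod_4 by (metis dvd_minus_mod)

text \<open>
  The exponent in the definition of \<^const>\<open>dlog4\<close> is an arbitrary one. Any two differ by a multiple
  of \<open>CARD('a) - 1\<close>, hence of 4.
\<close>

lemma dlog4_power: "dlog4 w (w ^ j) = j mod 4"
proof -
  have eq: "i mod 4 = j mod 4" if "i \<le> j" "w ^ i = w ^ j" for i j
  proof -
    have "w ^ i * w ^ (j - i) = w ^ i * 1"
      using that by (metis le_add_diff_inverse mult_1_right power_add)
    then have "w ^ (j - i) = 1"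
      using w_nonzero by simp
    then have "4 dvd j - i"
      using primitive_root_power_eq_1_dvd[OF primitive_root] four_dvd dvd_trans by blast
    then show ?thesis
      using \<open>i \<le> j\<close> by (metis mod_eq_dvd_iff_nat)
  qed
  have "w ^ j = w ^ (SOME i. w ^ j = w ^ i)"
    by (rule someI) simp
  then show ?thesis
    unfolding dlog4_def using eq by (metis nat_le_linear)
qed

lemma dlog4_less: "dlog4 w x < 4"
  by (simp add: dlog4_def)

lemma dlog4_mult:
  assumes "x \<noteq> 0" "y \<noteq> 0"
  shows "dlog4 w (x * y) = (dlog4 w x + dlog4 w y) mod 4"
proof -
  obtain i j where "x = w ^ i" "y = w ^ j"
    using ex_power assms by meson
  then show ?thesis
    by (simp add: dlog4_power mod_add_eq flip: power_add)
qed

lemma dlog4_power_left: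
  assumes "x \<noteq> 0"
  shows "dlog4 w (x ^ n) = (n * dlog4 w x) mod 4"
proof -
  obtain i where "x = w ^ i"
    using ex_power assms by blast
  then show ?thesis
    by (simp add: dlog4_power mod_mult_right_eq mult.commute flip: power_mult)
qed

text \<open>As \<open>- 1\<close> squares to 1, its logarithm is a multiple of half the order of the group.\<close>

lemma dlog4_minus_one:
  shows "even (dlog4 w (- 1))" and "CARD('a) mod 8 = 1 \<Longrightarrow> dlog4 w (- 1) = 0"
proof -
  obtain h where h: "- 1 = w ^ h"
    using ex_power[of "- 1"] by auto
  then have "w ^ (2 * h) = 1"
    by (metis mult.commute power_mult power_minus1_even power_one_right power2_minus power_one)
  then have "CARD('a) - 1 dvd 2 * h"
    by (rule primitive_root_power_eq_1_dvd[OF primitive_root])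
  then have "2 * c dvd 2 * h" if "2 * c dvd CARD('a) - 1" for c
    using that dvd_trans by blast
  then have dvd: "2 * c dvd CARD('a) - 1 \<Longrightarrow> c dvd h" for c
    by simp
  have "even h"
    using dvd[of 2] four_dvd by simp
  then show "even (dlog4 w (- 1))"
    by (simp add: h dlog4_power dvd_mod)
  assume "CARD('a) mod 8 = 1"
  then have "8 dvd CARD('a) - 1"
    by (metis dvd_minus_mod)
  then show "dlog4 w (- 1) = 0"
    using dvd[of 4] by (simp add: h dlog4_power)
qed

lemma dlog4_diff_commute:
  assumes "x \<noteq> y"
  shows "dlog4 w (y - x) = (dlog4 w (- 1) + dlog4 w (x - y)) mod 4"
  using dlog4_mult[of "- 1" "x - y"] assms by simp

section \<open>Adjacency in the Paley and Peisert graphs\<close>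

lemma parcs_graph_of_edges:
  "(x, y) \<in> parcs (graph_of_edges V {{x, y} | x y. P x y}) \<longleftrightarrow> P x y \<or> P y x"
  by (auto simp: graph_of_edges_def doubleton_eq_iff)

lemma quadratic_residue_iff: "quadratic_residue x \<longleftrightarrow> x \<noteq> 0 \<and> even (dlog4 w x)"
proof
  assume "quadratic_residue x"
  then obtain z where "x = z ^ 2" "z \<noteq> 0"
    by (auto simp: quadratic_residue_def)
  then show "x \<noteq> 0 \<and> even (dlog4 w x)"
    by (simp add: dlog4_power_left dvd_mod)
next
  assume x: "x \<noteq> 0 \<and> even (dlog4 w x)"
  then obtain j where j: "x = w ^ j"
    using ex_power by blast
  then have "even j"
    using x by (simp add: dlog4_power dvd_mod_iff)
  then have "x = (w ^ (j div 2)) ^ 2"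
    by (simp add: j flip: power_mult)
  then show "quadratic_residue x"
    unfolding quadratic_residue_def using x by blast
qed

lemma paley_adjacent_iff:
  "(x, y) \<in> parcs paley_graph \<longleftrightarrow> x \<noteq> y \<and> even (dlog4 w (x - y))"
proof -
  have "even (dlog4 w (y - x)) \<longleftrightarrow> even (dlog4 w (x - y))" if "x \<noteq> y"
    using dlog4_diff_commute[OF that] dlog4_minus_one(1) by (simp add: dvd_mod_iff)
  then show ?thesis
    unfolding paley_graph_def parcs_graph_of_edges quadratic_residue_iff by auto
qed

lemma peisert_adjacent_iff:
  assumes "CARD('a) mod 8 = 1"
  shows "(x, y) \<in> parcs (peisert_graph w) \<longleftrightarrow> x \<noteq> y \<and> dlog4 w (x - y) \<in> {0, 1}"
proof -
  have conn: "(\<exists>j::nat. (j mod 4 = 0 \<or> j mod 4 = 1) \<and> d = w ^ j) \<longleftrightarrow>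
      d \<noteq> 0 \<and> dlog4 w d \<in> {0, 1}" for d
  proof
    assume "d \<noteq> 0 \<and> dlog4 w d \<in> {0, 1}"
    moreover from this obtain j where "d = w ^ j"
      using ex_power by blast
    ultimately show "\<exists>j::nat. (j mod 4 = 0 \<or> j mod 4 = 1) \<and> d = w ^ j"
      by (intro exI[of _ j]) (simp add: dlog4_power)
  qed (auto simp: dlog4_power w_nonzero)
  have "dlog4 w (y - x) = dlog4 w (x - y)" if "x \<noteq> y"
    using dlog4_diff_commute[OF that] dlog4_minus_one(2)[OF assms] dlog4_less by simp
  then show ?thesis
    unfolding peisert_graph_def parcs_graph_of_edges conn by auto
qed

section \<open>Double transitivity up to complementation\<close>

text \<open>
  All maps needed have the form \<open>z \<mapsto> c * (z - y) ^ t + y'\<close>, with \<open>t = 1\<close> or with \<open>t\<close> the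
  characteristic of the field. The constant is forced by the images of \<open>x\<close> and \<open>y\<close>.
\<close>

lemma semiaffine_map:
  fixes x y x' y' :: 'a
  assumes add: "\<And>a b :: 'a. (a - b) ^ t = a ^ t - b ^ t"
    and "x \<noteq> y" "x' \<noteq> y'" "t > 0"
  shows "\<exists>\<phi> e. inj \<phi> \<and> \<phi> x = x' \<and> \<phi> y = y' \<and>
    (\<forall>a b. a \<noteq> b \<longrightarrow> dlog4 w (\<phi> a - \<phi> b) = (e + t * dlog4 w (a - b)) mod 4) \<and>
    dlog4 w (x' - y') = (e + t * dlog4 w (x - y)) mod 4"
proof -
  define c where "c = (x' - y') / (x - y) ^ t"
  define \<phi> where "\<phi> z = c * (z - y) ^ t + y'" for z
  have c: "c \<noteq> 0"
    using assms(2,3) by (simp add: c_def)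
  have diff: "\<phi> a - \<phi> b = c * (a - b) ^ t" for a b
    using add[of "a - y" "b - y"] by (simp add: \<phi>_def right_diff_distrib)
  have "inj \<phi>"
    using diff c by (intro injI) (metis eq_iff_diff_eq_0 mult_eq_0_iff power_not_zero)
  moreover have img: "\<phi> x = x'" "\<phi> y = y'"
    using assms(2-4) by (simp_all add: \<phi>_def c_def)
  moreover have cls: "dlog4 w (\<phi> a - \<phi> b) = (dlog4 w c + t * dlog4 w (a - b)) mod 4"
    if "a \<noteq> b" for a b
    using that c by (simp add: diff dlog4_mult dlog4_power_left mod_simps)
  ultimately show ?thesis
    using cls[OF \<open>x \<noteq> y\<close>] by blast
qed

lemma paley_doubly_transitive:
  fixes x y x' y' :: 'a
  assumes "x \<noteq> y" "x' \<noteq> y'"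
  shows "\<exists>\<phi> s. inj \<phi> \<and> \<phi> x = x' \<and> \<phi> y = y' \<and> (\<forall>a b. a \<noteq> b \<longrightarrow>
    (((a, b) \<in> parcs paley_graph \<longleftrightarrow> (\<phi> a, \<phi> b) \<in> parcs paley_graph) \<longleftrightarrow> s))"
proof -
  obtain \<phi> e where \<phi>: "inj \<phi>" "\<phi> x = x'" "\<phi> y = y'"
    and e: "\<And>a b. a \<noteq> b \<Longrightarrow> dlog4 w (\<phi> a - \<phi> b) = (e + dlog4 w (a - b)) mod 4"
    using semiaffine_map[of 1, OF _ assms] by auto
  have "((a, b) \<in> parcs paley_graph \<longleftrightarrow> (\<phi> a, \<phi> b) \<in> parcs paley_graph) \<longleftrightarrow> even e"
    if "a \<noteq> b" for a b
    using that e[OF that] \<phi>(1) by (auto simp: paley_adjacent_iff inj_eq dvd_mod_iff)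
  then show ?thesis
    using \<phi> by blast
qed

text \<open>
  An affine map works when the given differences have classes of the same parity. Otherwise the
  Frobenius map supplies the missing change of parity: its exponent \<open>p\<close> acts on classes as
  \<open>- 1\<close>, and \<open>j \<mapsto> e - j\<close> maps \<open>{0, 1}\<close> to itself for \<open>e = 1\<close> and to \<open>{2, 3}\<close> for \<open>e = 3\<close>.
\<close>

lemma peisert_doubly_transitive:
  fixes x y x' y' :: 'a
  assumes char: "CHAR('a) mod 4 = 3" and "CARD('a) mod 8 = 1" and xy: "x \<noteq> y" "x' \<noteq> y'"
  shows "\<exists>\<phi> s. inj \<phi> \<and> \<phi> x = x' \<and> \<phi> y = y' \<and> (\<forall>a b. a \<noteq> b \<longrightarrow>
    (((a, b) \<in> parcs (peisert_graph w) \<longleftrightarrow> (\<phi> a, \<phi> b) \<in> parcs (peisert_graph w)) \<longleftrightarrow> s))"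
proof (cases "even (dlog4 w (x - y) + dlog4 w (x' - y'))")
  case True
  obtain \<phi> e where \<phi>: "inj \<phi>" "\<phi> x = x'" "\<phi> y = y'"
    and e: "\<And>a b. a \<noteq> b \<Longrightarrow> dlog4 w (\<phi> a - \<phi> b) = (e + dlog4 w (a - b)) mod 4"
    and xe: "dlog4 w (x' - y') = (e + dlog4 w (x - y)) mod 4"
    using semiaffine_map[of 1, OF _ xy] by auto
  have "even e"
    using True xe by presburger
  have arith: "(c \<in> {0, 1} \<longleftrightarrow> (e + c) mod 4 \<in> {0, 1}) \<longleftrightarrow> e mod 4 = 0" if "c < 4" for c
  proof -
    have "(c \<in> {0, 1} \<longleftrightarrow> (f + c) mod 4 \<in> {0, 1}) \<longleftrightarrow> f = 0"
      if "f = 0 \<or> f = 2" "c = 0 \<or> c = 1 \<or> c = 2 \<or> c = 3" for f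
      using that by (elim disjE) simp_all
    moreover have "e mod 4 = 0 \<or> e mod 4 = 2"
      using \<open>even e\<close> by presburger
    moreover have "c = 0 \<or> c = 1 \<or> c = 2 \<or> c = 3"
      using that by auto
    ultimately show ?thesis
      using mod_add_left_eq[of e 4 "c"] by metis
  qed
  have "((a, b) \<in> parcs (peisert_graph w) \<longleftrightarrow> (\<phi> a, \<phi> b) \<in> parcs (peisert_graph w))
      \<longleftrightarrow> e mod 4 = 0" if "a \<noteq> b" for a b
  proof -
    have "\<phi> a \<noteq> \<phi> b"
      using that \<phi>(1) by (simp add: inj_eq)
    then show ?thesis
      unfolding peisert_adjacent_iff[OF assms(2)] e[OF that]
      using arith[OF dlog4_less[of "a - b"]] that by (simp only: simp_thms)
  qed
  then show ?thesis
    using \<phi> by blast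
next
  case False
  let ?p = "CHAR('a)"
  have prime: "prime ?p"
    using prime_CHAR_semidom[where ?'a = 'a] finite_imp_CHAR_pos[where ?'a = 'a] by simp
  have frob: "(a - b) ^ ?p = a ^ ?p - b ^ ?p" for a b :: 'a
    using freshmans_dream[OF prime refl, of "a - b" b] by (simp add: algebra_simps)
  obtain \<phi> e where \<phi>: "inj \<phi>" "\<phi> x = x'" "\<phi> y = y'"
    and e: "\<And>a b. a \<noteq> b \<Longrightarrow> dlog4 w (\<phi> a - \<phi> b) = (e + ?p * dlog4 w (a - b)) mod 4"
    and xe: "dlog4 w (x' - y') = (e + ?p * dlog4 w (x - y)) mod 4"
    using semiaffine_map[of ?p, OF frob xy] prime_gt_0_nat[OF prime] by blast
  have three: "(e + ?p * c) mod 4 = (e + 3 * c) mod 4" for c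
    using char by (metis mod_add_right_eq mod_mult_left_eq)
  have "odd e"
    using False xe unfolding three by presburger
  have arith: "(c \<in> {0, 1} \<longleftrightarrow> (e + 3 * c) mod 4 \<in> {0, 1}) \<longleftrightarrow> e mod 4 = 1" if "c < 4" for c
  proof -
    have "(c \<in> {0, 1} \<longleftrightarrow> (f + 3 * c) mod 4 \<in> {0, 1}) \<longleftrightarrow> f = 1"
      if "f = 1 \<or> f = 3" "c = 0 \<or> c = 1 \<or> c = 2 \<or> c = 3" for f
      using that by (elim disjE) simp_all
    moreover have "e mod 4 = 1 \<or> e mod 4 = 3"
      using \<open>odd e\<close> by presburger
    moreover have "c = 0 \<or> c = 1 \<or> c = 2 \<or> c = 3"
      using that by auto
    ultimately show ?thesis
      using mod_add_left_eq[of e 4 "3 * c"] by metis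
  qed
  have "((a, b) \<in> parcs (peisert_graph w) \<longleftrightarrow> (\<phi> a, \<phi> b) \<in> parcs (peisert_graph w))
      \<longleftrightarrow> e mod 4 = 1" if "a \<noteq> b" for a b
  proof -
    have "\<phi> a \<noteq> \<phi> b"
      using that \<phi>(1) by (simp add: inj_eq)
    then show ?thesis
      unfolding peisert_adjacent_iff[OF assms(2)] e[OF that] three
      using arith[OF dlog4_less[of "a - b"]] that by (simp only: simp_thms)
  qed
  then show ?thesis
    using \<phi> by blast
qed

end

section \<open>The design\<close>

lemma CHAR_eq_if_CARD_eq_prime_power:
  assumes "prime p" and "CARD('a::{field,finite}) = p ^ r"
  shows "CHAR('a) = p"
proof -
  have "prime (CHAR('a))"
    using prime_CHAR_semidom[where ?'a = 'a] finite_imp_CHAR_pos[where ?'a = 'a] by simp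
  moreover have "CHAR('a) dvd p ^ r"
    using CHAR_dvd_CARD[where ?'a = 'a] assms(2) by simp
  ultimately show ?thesis
    using assms(1) by (metis prime_dvd_power primes_dvd_imp_eq)
qed

lemma paley_or_peisert_doubly_transitive:
  fixes G :: "'a::{field,finite} pair_pre_digraph"
  assumes "prime p" and CARD: "CARD('a) = p ^ r" "CARD('a) mod 4 = 1"
    and G: "G = paley_graph \<or>
         (even r \<and> p mod 4 = 3 \<and> (\<exists>w. primitive_root w \<and> G = peisert_graph w))"
    and xy: "x \<noteq> y" "x' \<noteq> y'"
  shows "\<exists>\<phi> s. inj \<phi> \<and> \<phi> x = x' \<and> \<phi> y = y' \<and>
    (\<forall>a b. a \<noteq> b \<longrightarrow> (((a, b) \<in> parcs G \<longleftrightarrow> (\<phi> a, \<phi> b) \<in> parcs G) \<longleftrightarrow> s))"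
  using G
proof (elim disjE conjE exE)
  assume G: "G = paley_graph"
  obtain w :: 'a where "primitive_root w"
    using ex_primitive_root by blast
  then interpret field_1_mod_4 w
    using CARD by unfold_locales
  show ?thesis
    unfolding G by (rule paley_doubly_transitive[OF xy])
next
  fix w assume r: "even r" and p: "p mod 4 = 3" and "primitive_root w" and G: "G = peisert_graph w"
  then interpret field_1_mod_4 w
    using CARD by unfold_locales
  \<comment> \<open>The square of an odd number is 1 modulo 8, and \<open>q\<close> is a power of \<open>p ^ 2\<close>.\<close>
  have "p mod 8 = 3 \<or> p mod 8 = 7"
    using p by presburger
  then have "p ^ 2 mod 8 = 1"
    by (auto simp: power_mod[of p 8 2, symmetric])
  moreover have "(p ^ 2) ^ (r div 2) mod 8 = (p ^ 2 mod 8) ^ (r div 2) mod 8"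
    by (simp only: power_mod)
  ultimately have "CARD('a) mod 8 = 1"
    using r CARD(1) by (simp add: power_mult[symmetric])
  moreover have "CHAR('a) mod 4 = 3"
    using CHAR_eq_if_CARD_eq_prime_power[OF assms(1) CARD(1)] p by simp
  ultimately show ?thesis
    unfolding G by (intro peisert_doubly_transitive xy)
qed

theorem theorem1p1:
  fixes p q r k m :: nat
    and G :: "'a::{field,finite} pair_pre_digraph"
    and H :: "nat \<Rightarrow> 'b pair_pre_digraph"
  assumes "prime p" and "r \<ge> 1" and "q = p ^ r" and "q mod 4 = 1"
    and "CARD('a) = q"
    and "G = paley_graph \<or>
         (even r \<and> p mod 4 = 3 \<and> (\<exists>w. primitive_root w \<and> G = peisert_graph w))"
    and "k \<ge> 1" and "m \<ge> 1"
    and "\<And>i. i \<in> {1..m} \<Longrightarrow> pair_graph (H i) \<and> card (pverts (H i)) = k"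
    and "\<And>i j. i \<in> {1..m} \<Longrightarrow> j \<in> {1..m} \<Longrightarrow> i \<noteq> j \<Longrightarrow>
           \<not> digraph_iso (with_proj (H i)) (with_proj (H j))"
    and "\<And>i j. i \<in> {1..m} \<Longrightarrow> j \<in> {1..m} \<Longrightarrow> i \<noteq> j \<Longrightarrow>
           \<not> digraph_iso (with_proj (H i)) (with_proj (graph_complement (H j)))"
  shows "\<exists>l::nat.
           two_design (pverts G) (\<Union>i\<in>{1..m}. induced_copies_tilde (H i) G) q k l \<and>
           real l = real (k choose 2) * inverse (real (q choose 2)) *
                    (\<Sum>i=1..m. real (card (induced_copies_tilde (H i) G)))"
proof -
  have G: "pair_graph G"
    using assms(6) pair_graph_paley_graph pair_graph_peisert_graph by blast
  have V: "pverts G = UNIV"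
    using assms(6) by (auto simp: paley_graph_def peisert_graph_def graph_of_edges_def)
  let ?T = "\<lambda>i. induced_copies_tilde (H i) G"
  let ?B = "\<Union>i\<in>{1..m}. ?T i"
  have T: "X \<in> ?T i \<longleftrightarrow> iso_or_anti (parcs G) X (parcs (H i)) (pverts (H i))"
    if "i \<in> {1..m}" for i X
    using induced_copies_tilde_eq[OF G] assms(9)[OF that] V by auto
  have "p ^ 1 \<le> p ^ r"
    using assms(2) prime_ge_1_nat[OF assms(1)] by (intro power_increasing) auto
  then have q: "q \<ge> 2"
    using assms(1,3) prime_ge_2_nat[of p] by simp
  have "\<exists>\<phi>. inj_on \<phi> UNIV \<and> \<phi> x = x' \<and> \<phi> y = y' \<and> (\<forall>b\<in>?B. \<phi> ` b \<in> ?B)"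
    if xy: "x \<noteq> y" "x' \<noteq> y'" for x y x' y' :: 'a
  proof -
    have C: "CARD('a) = p ^ r" "CARD('a) mod 4 = 1"
      using assms(3,4,5) by auto
    obtain \<phi> s where \<phi>: "inj \<phi>" "\<phi> x = x'" "\<phi> y = y'"
      and s: "\<And>a b. a \<noteq> b \<Longrightarrow> ((a, b) \<in> parcs G \<longleftrightarrow> (\<phi> a, \<phi> b) \<in> parcs G) \<longleftrightarrow> s"
      using paley_or_peisert_doubly_transitive[OF assms(1) C assms(6) xy] by blast
    have "iso_or_anti (parcs G) b (parcs G) (\<phi> ` b)" for b
      unfolding iso_or_anti_def
      using inj_on_imp_bij_betw[OF inj_on_subset[OF \<phi>(1)], of b] s
      by (intro exI[of _ \<phi>] exI[of _ s]) simp
    then have "\<phi> ` b \<in> ?T i" if "i \<in> {1..m}" "b \<in> ?T i" for i b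
      using that(2) unfolding T[OF that(1)] by (metis iso_or_anti_sym iso_or_anti_trans)
    then have "\<forall>b\<in>?B. \<phi> ` b \<in> ?B"
      by blast
    then show ?thesis
      using \<phi> by blast
  qed
  moreover have "b \<subseteq> UNIV \<and> card b = k" if "b \<in> ?B" for b
    using that T assms(9) by (auto dest: iso_or_anti_imp_card_eq)
  ultimately obtain l where design: "two_design UNIV ?B (CARD('a)) k l"
    and count: "l * (CARD('a) choose 2) = card ?B * (k choose 2)"
    using two_design_if_doubly_transitive[of "UNIV :: 'a set" ?B k] q assms(5) by auto
  have "?T i \<inter> ?T j = {}" if ij: "i \<in> {1..m}" "j \<in> {1..m}" "i \<noteq> j" for i j
  proof (rule ccontr)
    assume "?T i \<inter> ?T j \<noteq> {}"
    then obtain X where "iso_or_anti (parcs G) X (parcs (H i)) (pverts (H i))"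
      and "iso_or_anti (parcs G) X (parcs (H j)) (pverts (H j))"
      using T[OF ij(1)] T[OF ij(2)] by blast
    then have "iso_or_anti (parcs (H i)) (pverts (H i)) (parcs (H j)) (pverts (H j))"
      using iso_or_anti_sym iso_or_anti_trans by metis
    then show False
      using digraph_iso_or_complement_iff[of "H i" "H j"] assms(9,10,11) ij by blast
  qed
  then have "card ?B = (\<Sum>i=1..m. card (?T i))"
    by (intro card_UN_disjoint) auto
  then have "real l * real (q choose 2) =
      real (k choose 2) * (\<Sum>i=1..m. real (card (?T i)))"
    using count assms(5) by (simp flip: of_nat_mult of_nat_sum add: mult.commute)
  moreover have "real (q choose 2) \<noteq> 0"
    using q by simp
  ultimately have "real l = real (k choose 2) * inverse (real (q choose 2)) *
      (\<Sum>i=1..m. real (card (?T i)))"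
    by (simp add: field_simps)
  then show ?thesis
    using design V assms(5) by auto
qed

end
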